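(* Let $p$ be a prime and let $\nu$ be a positive integer. Let $A$ be a finite abelian group of exponent $N$. Let $r_I$ be the number of $p^\nu$-cyclotomic classes of $A$ of type $I$ and $2r_{II}$ the number of those of type $II$. If $p\nmid N$, then $$r_I+r_{II}=\sum_{d\mid N}\chi(d,p^\nu)\frac{\mathcal{N}_A(d)}{\mathrm{ord}_d(p^\nu)}+\frac12\sum_{d\mid N}\left(1-\chi(d,p^\nu)\right)\frac{\mathcal{N}_A(d)}{\mathrm{ord}_d(p^\nu)},$$ where $\mathcal{N}_A(d)$ denotes the number of elements of order $d$ in $A$.
   Context: For $a\in A$ (written additively), $S_{p^\nu}(a)=\{p^{\nu i}\cdot a : i\ge 0\}$ is the $p^\nu$-cyclotomic class of $a$ (these classes partition $A$ when $p\nmid |A|$); it is of type $I$ if $S_{p^\nu}(a)=S_{p^\nu}(-a)$ and of type $II$ otherwise. Classes of type $II$ come in pairs $S_{p^\nu}(a)\neq S_{p^\nu}(-a)$. $\mathrm{ord}_d(m)$ denotes the multiplicative order of $m$ modulo $d$ (equal to $1$ for $d=1$). $\chi(d,p^\nu)=1$ if there exists a positive integer $i$ such that $d\mid (p^{\nu i}+1)$, and $\chi(d,p^\nu)=0$ otherwise. *)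

theory Defs
  imports "HOL-Algebra.Algebra" "HOL-Number_Theory.Number_Theory"
begin

text \<open>
  Abelian groups are rendered as \<open>comm_group\<close>, hence multiplicatively: the multiple
  \<open>k \<cdot> a\<close> becomes \<open>a [^] k\<close> and \<open>- a\<close> becomes \<open>inv a\<close>.
  In the definitions below \<open>q\<close> stands for the prime power \<open>p ^ \<nu>\<close>.
\<close>

definition group_exponent :: "('a, 'b) monoid_scheme \<Rightarrow> nat" where
  "group_exponent G = (LEAST n. 0 < n \<and> (\<forall>x\<in>carrier G. x [^]\<^bsub>G\<^esub> n = \<one>\<^bsub>G\<^esub>))"

definition cyclotomic_class :: "('a, 'b) monoid_scheme \<Rightarrow> nat \<Rightarrow> 'a \<Rightarrow> 'a set" where
  "cyclotomic_class G q a = {a [^]\<^bsub>G\<^esub> (q ^ i) | i :: nat. True}"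

definition type_I_classes :: "('a, 'b) monoid_scheme \<Rightarrow> nat \<Rightarrow> 'a set set" where
  "type_I_classes G q = {cyclotomic_class G q a | a.
     a \<in> carrier G \<and> cyclotomic_class G q a = cyclotomic_class G q (inv\<^bsub>G\<^esub> a)}"

definition type_II_classes :: "('a, 'b) monoid_scheme \<Rightarrow> nat \<Rightarrow> 'a set set" where
  "type_II_classes G q = {cyclotomic_class G q a | a.
     a \<in> carrier G \<and> cyclotomic_class G q a \<noteq> cyclotomic_class G q (inv\<^bsub>G\<^esub> a)}"

definition chi :: "nat \<Rightarrow> nat \<Rightarrow> nat" where
  "chi d q = (if \<exists>i>0. d dvd q ^ i + 1 then 1 else 0)"

definition num_of_order :: "('a, 'b) monoid_scheme \<Rightarrow> nat \<Rightarrow> nat" where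
  "num_of_order G d = card {x \<in> carrier G. group.ord G x = d}"

lemma cyclotomic_class_inv:
  assumes "comm_group G" "a \<in> carrier G"
  shows "cyclotomic_class G q (inv\<^bsub>G\<^esub> a) = m_inv G ` cyclotomic_class G q a"
proof -
  interpret comm_group G by fact
  show ?thesis
    using assms(2) by (auto simp: cyclotomic_class_def nat_pow_inv)
qed

text \<open>
  The classes of type II come in pairs, so a natural number \<open>r_II\<close> with
  \<open>2 * r_II = card (type_II_classes G q)\<close> always exists.
\<close>

lemma even_card_type_II_classes:
  assumes "comm_group G" "finite (carrier G)"
  shows "even (card (type_II_classes G q))"
proof -
  interpret comm_group G by fact
  let ?S = "cyclotomic_class G q" and ?T = "type_II_classes G q"
  define f where "f = (\<lambda>C. m_inv G ` C)"
  have f_S: "f (?S a) = ?S (inv\<^bsub>G\<^esub> a)" if "a \<in> carrier G" for a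
    using cyclotomic_class_inv[OF assms(1) that] by (simp add: f_def)
  have f: "f C \<in> ?T" "f (f C) = C" "f C \<noteq> C" if C: "C \<in> ?T" for C
  proof -
    obtain a where a: "a \<in> carrier G" "C = ?S a" "?S a \<noteq> ?S (inv\<^bsub>G\<^esub> a)"
      using C unfolding type_II_classes_def by blast
    have i: "inv\<^bsub>G\<^esub> a \<in> carrier G" "inv\<^bsub>G\<^esub> (inv\<^bsub>G\<^esub> a) = a" using a by simp_all
    have fC: "f C = ?S (inv\<^bsub>G\<^esub> a)" using a(1,2) f_S by simp
    show "f C \<noteq> C" using a fC by simp
    show "f (f C) = C" unfolding fC using f_S[OF i(1)] i(2) a(2) by simp
    have "?S (inv\<^bsub>G\<^esub> a) \<noteq> ?S (inv\<^bsub>G\<^esub> (inv\<^bsub>G\<^esub> a))" using a(3) i(2) by simp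
    thus "f C \<in> ?T" unfolding type_II_classes_def fC using i(1) by blast
  qed
  define P where "P = (\<lambda>C. {C, f C}) ` ?T"
  have "?T = ?S ` {a \<in> carrier G. ?S a \<noteq> ?S (inv\<^bsub>G\<^esub> a)}"
    unfolding type_II_classes_def by blast
  hence fin: "finite ?T" using assms(2) by simp
  have U: "\<Union>P = ?T" using f(1) by (auto simp: P_def)
  have "2 * card P = card (\<Union>P)"
  proof (rule card_partition)
    show "finite P" using fin by (simp add: P_def)
    show "finite (\<Union>P)" using fin U by simp
    show "card c = 2" if "c \<in> P" for c
    proof -
      obtain C where "C \<in> ?T" "c = {C, f C}" using \<open>c \<in> P\<close> by (auto simp: P_def)
      thus ?thesis using f(3)[of C] by (simp add: card_insert_if)
    qed
    show "c1 \<inter> c2 = {}" if "c1 \<in> P" "c2 \<in> P" "c1 \<noteq> c2" for c1 c2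
    proof -
      obtain C where C: "C \<in> ?T" "c1 = {C, f C}" using \<open>c1 \<in> P\<close> by (auto simp: P_def)
      obtain D where D: "D \<in> ?T" "c2 = {D, f D}" using \<open>c2 \<in> P\<close> by (auto simp: P_def)
      have "C \<noteq> D" "C \<noteq> f D" "D \<noteq> f C" "f C \<noteq> f D"
        using C(2) D(2) f(2)[OF C(1)] f(2)[OF D(1)] \<open>c1 \<noteq> c2\<close> by (metis insert_commute)+
      thus ?thesis unfolding C(2) D(2) by blast
    qed
  qed
  thus ?thesis unfolding U by (rule dvdI[OF sym])
qed

end

theory Submission
  imports Defs
begin

text \<open>
  If \<open>x\<close> has order \<open>d\<close> prime to \<open>q\<close>, its \<open>q\<close>-cyclotomic class has exactly
  \<open>ord\<^sub>d(q)\<close> elements, so giving each \<open>x\<close> the weight \<open>1 / ord\<^sub>d(q)\<close> counts the classes.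
  The class is of type I iff \<open>-1\<close> is a power of \<open>q\<close> modulo \<open>d\<close>, which depends only on \<open>d\<close>;
  grouping the elements by their order yields the formula.
\<close>

text \<open>On the fibre over a value \<open>z\<close> the weight is constantly the reciprocal of
  the size of the fibre, so each nonempty fibre contributes exactly 1. With \<open>f\<close> the map
  from an element to its class, this counts classes by summing over elements.\<close>

lemma card_image_eq_sum_inverse_card_fibres:
  assumes "finite B"
  shows "real (card (f ` B)) = (\<Sum>x\<in>B. 1 / real (card {y \<in> B. f y = f x}))"
proof -
  have "(\<Sum>x\<in>{x \<in> B. f x = z}. 1 / real (card {y \<in> B. f y = f x})) = 1" if "z \<in> f ` B" for z
  proof -
    have "(\<Sum>x\<in>{x \<in> B. f x = z}. 1 / real (card {y \<in> B. f y = f x})) =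
        (\<Sum>x\<in>{x \<in> B. f x = z}. 1 / real (card {y \<in> B. f y = z}))"
      by (rule sum.cong) auto
    moreover have "card {y \<in> B. f y = z} \<noteq> 0"
      using that assms by auto
    ultimately show ?thesis
      by simp
  qed
  then show ?thesis
    unfolding sum.image_gen[OF assms, of _ f] by simp
qed

lemma (in group) nat_pow_eq_iff_cong:
  assumes "x \<in> carrier G"
  shows "x [^] (m::nat) = x [^] (n::nat) \<longleftrightarrow> [m = n] (mod ord x)"
proof -
  have "x [^] m = x [^] n \<longleftrightarrow> x [^] int m = x [^] int n"
    by (simp add: int_pow_int)
  also have "\<dots> \<longleftrightarrow> int (ord x) dvd int n - int m"
    using assms by (simp add: int_pow_eq)
  also have "\<dots> \<longleftrightarrow> [m = n] (mod ord x)"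
    by (metis cong_iff_dvd_diff cong_int_iff cong_sym)
  finally show ?thesis .
qed

lemma (in group) ord_dvd_group_exponent:
  assumes "finite (carrier G)" "x \<in> carrier G"
  shows "ord x dvd group_exponent G" "group_exponent G > 0"
proof -
  let ?P = "\<lambda>n::nat. 0 < n \<and> (\<forall>x\<in>carrier G. x [^] n = \<one>)"
  \<comment> \<open>By Lagrange the group order satisfies the condition under \<open>LEAST\<close>,
    so the minimum satisfies it too.\<close>
  have "?P (order G)"
    using assms by (simp add: pow_order_eq_1 order_gt_0_iff_finite)
  then have "?P (group_exponent G)"
    unfolding group_exponent_def by (rule LeastI)
  then show "ord x dvd group_exponent G" "group_exponent G > 0"
    using assms by (auto simp flip: pow_eq_id)
qed

lemma cyclotomic_class_eq_image:
  "cyclotomic_class G q x = range (\<lambda>i. x [^]\<^bsub>G\<^esub> (q ^ i))"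
  by (auto simp: cyclotomic_class_def)

text \<open>Powers of \<open>x\<close> depend on the exponent modulo \<open>ord x\<close>, and
  powers of \<open>q\<close> modulo \<open>ord x\<close> depend on their exponent modulo the
  multiplicative order of \<open>q\<close>. So \<open>i\<close> runs through one period without
  repetition.\<close>

lemma (in group) card_cyclotomic_class:
  assumes "x \<in> carrier G" "coprime (ord x) q"
  shows "card (cyclotomic_class G q x) = Pocklington.ord (ord x) q"
proof -
  let ?k = "Pocklington.ord (ord x) q" and ?f = "\<lambda>i. x [^] (q ^ i)"
  have eq: "?f i = ?f j \<longleftrightarrow> [i = j] (mod ?k)" for i j
    using assms by (simp add: nat_pow_eq_iff_cong order_divides_expdiff)
  \<comment> \<open>\<open>Pocklington.ord\<close> takes the value 0 when the arguments are not
    coprime; coprimality excludes this.\<close>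
  have "?k > 0"
    using assms by simp
  then have "?f i \<in> ?f ` {..<?k}" for i
    by (rule_tac image_eqI[of _ _ "i mod ?k"]) (auto simp: eq cong_def)
  then have "cyclotomic_class G q x = ?f ` {..<?k}"
    unfolding cyclotomic_class_eq_image by blast
  moreover have "inj_on ?f {..<?k}"
    by (auto simp: inj_on_def eq cong_def)
  ultimately show ?thesis
    by (simp add: card_image)
qed

lemma (in group) self_mem_cyclotomic_class:
  "x \<in> carrier G \<Longrightarrow> x \<in> cyclotomic_class G q x"
  unfolding cyclotomic_class_eq_image by (rule range_eqI[of _ _ 0]) simp

lemma (in group) cyclotomic_class_subset:
  assumes "x \<in> carrier G" "y \<in> cyclotomic_class G q x"
  shows "cyclotomic_class G q y \<subseteq> cyclotomic_class G q x"
proof -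
  obtain i where "y = x [^] (q ^ i)"
    using assms(2) by (auto simp: cyclotomic_class_def)
  then have "y [^] (q ^ j) = x [^] (q ^ (i + j))" for j
    using assms(1) by (simp add: nat_pow_pow power_add)
  then show ?thesis
    by (auto simp: cyclotomic_class_eq_image)
qed

text \<open>Membership is symmetric because \<open>q\<close> is invertible modulo
  \<open>ord x\<close>: further powers of \<open>q\<close> lead from \<open>y\<close> back to
  \<open>x\<close>. The two inclusions then follow by transitivity.\<close>

lemma (in group) cyclotomic_class_eq_iff:
  assumes x: "x \<in> carrier G" and y: "y \<in> carrier G" and q: "coprime (ord x) q"
  shows "cyclotomic_class G q y = cyclotomic_class G q x \<longleftrightarrow> y \<in> cyclotomic_class G q x"
proof
  assume "cyclotomic_class G q y = cyclotomic_class G q x"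
  then show "y \<in> cyclotomic_class G q x"
    using self_mem_cyclotomic_class[OF y, of q] by simp
next
  assume mem: "y \<in> cyclotomic_class G q x"
  then obtain i where i: "y = x [^] (q ^ i)"
    by (auto simp: cyclotomic_class_def)
  let ?k = "Pocklington.ord (ord x) q"
  have "?k > 0"
    using q by simp
  \<comment> \<open>The exponent \<open>?k * i - i\<close> completes \<open>i\<close> to a multiple
    of the period \<open>?k\<close>; this inequality keeps the subtraction on naturals from
    truncating.\<close>
  then have "i \<le> ?k * i"
    by (cases "?k") auto
  then have "y [^] (q ^ (?k * i - i)) = x [^] (q ^ (?k * i))"
    using x by (simp add: i nat_pow_pow flip: power_add)
  also have "\<dots> = x [^] (1::nat)"
    unfolding nat_pow_eq_iff_cong[OF x] by (simp add: ord_divides')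
  finally have "x = y [^] (q ^ (?k * i - i))"
    using x by simp
  then have "x \<in> cyclotomic_class G q y"
    unfolding cyclotomic_class_def by blast
  then show "cyclotomic_class G q y = cyclotomic_class G q x"
    using cyclotomic_class_subset[OF x mem] cyclotomic_class_subset[OF y] by blast
qed

lemma (in group) cyclotomic_class_eq_inv_iff_chi:
  assumes x: "x \<in> carrier G" and q: "coprime (ord x) q"
  shows "cyclotomic_class G q x = cyclotomic_class G q (inv x) \<longleftrightarrow> chi (ord x) q = 1"
proof -
  have pow_inv: "x [^] (q ^ i) = inv x \<longleftrightarrow> ord x dvd q ^ i + 1" for i
  proof -
    have "x [^] (q ^ i) = inv x \<longleftrightarrow> x [^] (q ^ i) \<otimes> x = \<one>"
      using x inv_equality by fastforce
    also have "\<dots> \<longleftrightarrow> x [^] (q ^ i + 1) = \<one>"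
      by simp
    finally show ?thesis
      using x by (simp only: pow_eq_id)
  qed
  have shift: "[q ^ (i + Pocklington.ord (ord x) q) = q ^ i] (mod ord x)" for i
    unfolding order_divides_expdiff[OF q] by (simp add: cong_def)
  have "cyclotomic_class G q x = cyclotomic_class G q (inv x) \<longleftrightarrow> inv x \<in> cyclotomic_class G q x"
    using cyclotomic_class_eq_iff[OF x inv_closed[OF x] q] by (simp only: eq_commute)
  also have "\<dots> \<longleftrightarrow> (\<exists>i. ord x dvd q ^ i + 1)"
    unfolding cyclotomic_class_def mem_Collect_eq by (subst eq_commute) (simp only: pow_inv simp_thms)
  \<comment> \<open>The class admits \<open>i = 0\<close>, which matters when \<open>x\<close> is
    its own inverse, whereas \<open>chi\<close> demands a positive exponent. Adding one full period,
    positive by coprimality, leaves the power of \<open>x\<close> unchanged.\<close>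
  also have "\<dots> \<longleftrightarrow> (\<exists>i>0. ord x dvd q ^ i + 1)"
  proof
    assume "\<exists>i. ord x dvd q ^ i + 1"
    then obtain i where "x [^] (q ^ i) = inv x"
      using pow_inv by blast
    then have "x [^] (q ^ (i + Pocklington.ord (ord x) q)) = inv x"
      using shift[of i] x by (simp only: flip: nat_pow_eq_iff_cong)
    then have "ord x dvd q ^ (i + Pocklington.ord (ord x) q) + 1"
      by (simp only: pow_inv)
    moreover have "i + Pocklington.ord (ord x) q > 0"
      using q by simp
    ultimately show "\<exists>i>0. ord x dvd q ^ i + 1"
      by blast
  qed blast
  also have "\<dots> \<longleftrightarrow> chi (ord x) q = 1"
    by (simp add: chi_def)
  finally show ?thesis .
qed

text \<open>Since \<open>P\<close> looks only at the class, the filtered set is a union of whole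
  classes. The fibre through \<open>x\<close> is therefore the entire class of \<open>x\<close>,
  whose size is known.\<close>

lemma (in group) card_cyclotomic_classes_filter:
  assumes fin: "finite (carrier G)"
    and q: "\<And>x. x \<in> carrier G \<Longrightarrow> coprime (ord x) q"
  shows "real (card (cyclotomic_class G q ` {x \<in> carrier G. P (cyclotomic_class G q x)})) =
    (\<Sum>x | x \<in> carrier G \<and> P (cyclotomic_class G q x). 1 / real (Pocklington.ord (ord x) q))"
proof -
  let ?S = "cyclotomic_class G q" and ?B = "{x \<in> carrier G. P (cyclotomic_class G q x)}"
  have "{y \<in> ?B. ?S y = ?S x} = ?S x" if x: "x \<in> ?B" for x
  proof -
    have "{y \<in> ?B. ?S y = ?S x} = {y \<in> carrier G. ?S y = ?S x}"
      using x by auto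
    also have "\<dots> = {y \<in> carrier G. y \<in> ?S x}"
      using x q by (intro Collect_cong conj_cong refl cyclotomic_class_eq_iff) auto
    also have "\<dots> = ?S x"
      using x by (auto simp: cyclotomic_class_def)
    finally show ?thesis .
  qed
  then show ?thesis
    using fin q by (simp add: card_image_eq_sum_inverse_card_fibres card_cyclotomic_class)
qed

lemma (in group) sum_over_orders:
  fixes f :: "nat \<Rightarrow> real"
  assumes "finite (carrier G)"
  shows "(\<Sum>d | d dvd group_exponent G. f d * real (num_of_order G d)) =
    (\<Sum>x\<in>carrier G. f (ord x))"
proof -
  let ?D = "{d. d dvd group_exponent G}"
  have "(\<Sum>d\<in>?D. \<Sum>x | x \<in> carrier G \<and> ord x = d. f (ord x)) = (\<Sum>x\<in>carrier G. f (ord x))"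
    \<comment> \<open>Every element order is a divisor of the exponent, and the exponent is
      positive, so its divisors form a finite index set.\<close>
    using assms ord_dvd_group_exponent[OF assms] by (intro sum.group finite_divisors_nat) auto
  then show ?thesis
    by (simp add: num_of_order_def mult.commute)
qed

theorem proposition4p5:
  fixes A :: "('a, 'b) monoid_scheme" and p \<nu> N r_I r_II :: nat
  assumes "Factorial_Ring.prime p" and "\<nu> > 0"
    and "comm_group A" and "finite (carrier A)"
    and "N = group_exponent A"
    and "r_I = card (type_I_classes A (p ^ \<nu>))"
    and "2 * r_II = card (type_II_classes A (p ^ \<nu>))"
    and "\<not> p dvd N"
  shows "real r_I + real r_II =
    (\<Sum>d | d dvd N. real (chi d (p ^ \<nu>)) * (real (num_of_order A d) / real (Pocklington.ord d (p ^ \<nu>))))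
    + 1 / 2 * (\<Sum>d | d dvd N. (1 - real (chi d (p ^ \<nu>)))
        * (real (num_of_order A d) / real (Pocklington.ord d (p ^ \<nu>))))"
proof -
  interpret comm_group A by fact
  define q where "q = p ^ \<nu>"
  let ?S = "cyclotomic_class A q"
  let ?w = "\<lambda>x. 1 / real (Pocklington.ord (ord x) q)"
  have q: "coprime (ord x) q" if "x \<in> carrier A" for x
  proof -
    have "\<not> p dvd ord x"
      using ord_dvd_group_exponent(1)[OF assms(4) that] assms(5,8) dvd_trans by blast
    then show ?thesis
      using assms(1) by (simp add: q_def coprime_commute prime_imp_coprime)
  qed
  \<comment> \<open>Being of type I becomes invariance of the class under inversion, a predicate on
    sets as \<open>card_cyclotomic_classes_filter\<close> requires.\<close>
  have self_inv: "?S x = ?S (inv\<^bsub>A\<^esub> x) \<longleftrightarrow> m_inv A ` ?S x = ?S x" if "x \<in> carrier A" for x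
    unfolding cyclotomic_class_inv[OF assms(3) that] by (rule eq_commute)
  have chi: "m_inv A ` ?S x = ?S x \<longleftrightarrow> chi (ord x) q = 1" if "x \<in> carrier A" for x
    using cyclotomic_class_eq_inv_iff_chi[OF that q[OF that]] self_inv[OF that] by simp
  have chi_01: "chi d q = 0 \<or> chi d q = 1" for d
    by (simp add: chi_def)
  have "type_I_classes A q = ?S ` {x \<in> carrier A. m_inv A ` ?S x = ?S x}"
    by (simp add: type_I_classes_def setcompr_eq_image self_inv cong: conj_cong)
  then have "real r_I = (\<Sum>x | x \<in> carrier A \<and> m_inv A ` ?S x = ?S x. ?w x)"
    using card_cyclotomic_classes_filter[OF assms(4) q, of "\<lambda>C. m_inv A ` C = C"] assms(6)
    by (simp add: q_def)
  also have "\<dots> = (\<Sum>x\<in>carrier A. if m_inv A ` ?S x = ?S x then ?w x else 0)"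
    using assms(4) by (rule sum.inter_filter)
  \<comment> \<open>As \<open>chi\<close> takes only the values 0 and 1, it is the indicator of type
    I, and the summand now depends on \<open>ord x\<close> alone.\<close>
  also have "\<dots> = (\<Sum>x\<in>carrier A. real (chi (ord x) q) * ?w x)"
  proof (rule sum.cong)
    fix x assume "x \<in> carrier A"
    then show "(if m_inv A ` ?S x = ?S x then ?w x else 0) = real (chi (ord x) q) * ?w x"
      using chi_01[of "ord x"] by (simp only: chi) auto
  qed simp
  also have "\<dots> = (\<Sum>d | d dvd N. real (chi d q) * (real (num_of_order A d) / real (Pocklington.ord d q)))"
    using sum_over_orders[OF assms(4), of "\<lambda>d. real (chi d q) * (1 / real (Pocklington.ord d q))"]
    by (simp add: assms(5))
  finally have I: "real r_I = \<dots>" .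
  have "type_II_classes A q = ?S ` {x \<in> carrier A. m_inv A ` ?S x \<noteq> ?S x}"
    by (simp add: type_II_classes_def setcompr_eq_image self_inv cong: conj_cong)
  \<comment> \<open>The weights count all type II classes, hence \<open>2 * r_II\<close>; halving at
    the end produces the factor 1/2 of the formula.\<close>
  then have "real (2 * r_II) = (\<Sum>x | x \<in> carrier A \<and> m_inv A ` ?S x \<noteq> ?S x. ?w x)"
    using card_cyclotomic_classes_filter[OF assms(4) q, of "\<lambda>C. m_inv A ` C \<noteq> C"] assms(7)
    by (simp add: q_def)
  also have "\<dots> = (\<Sum>x\<in>carrier A. if m_inv A ` ?S x \<noteq> ?S x then ?w x else 0)"
    using assms(4) by (rule sum.inter_filter)
  also have "\<dots> = (\<Sum>x\<in>carrier A. (1 - real (chi (ord x) q)) * ?w x)"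
  proof (rule sum.cong)
    fix x assume "x \<in> carrier A"
    then show "(if m_inv A ` ?S x \<noteq> ?S x then ?w x else 0) = (1 - real (chi (ord x) q)) * ?w x"
      using chi_01[of "ord x"] by (simp only: chi) auto
  qed simp
  also have "\<dots> = (\<Sum>d | d dvd N. (1 - real (chi d q)) * (real (num_of_order A d) / real (Pocklington.ord d q)))"
    using sum_over_orders[OF assms(4), of "\<lambda>d. (1 - real (chi d q)) * (1 / real (Pocklington.ord d q))"]
    by (simp add: assms(5))
  finally have "real (2 * r_II) = \<dots>" .
  with I show ?thesis
    by (simp add: q_def)
qed

end
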